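(* Let $p>3$ be a prime. Then $$\sum_{k=0}^{p-1}\frac{T_k}{3^k}\equiv\begin{cases}p\pmod{p^2}&\text{if }p\equiv1\pmod 3,\\ 0\pmod{p^2}&\text{if }p\equiv 2\pmod 3.\end{cases}$$
   Context: $T_k$ denotes the central trinomial coefficient, i.e. the constant term of $(1+x+x^{-1})^k$. Congruences of rationals with denominators prime to $p$ are understood in the ring of rationals with denominator prime to $p$. *)

theory Defs
  imports Complex_Main
    "HOL-Computational_Algebra.Formal_Laurent_Series"
    "HOL-Number_Theory.Cong"
begin

text \<open>Constant term of \<open>(1 + x + x\<^sup>-\<^sup>1)\<^sup>k\<close>, with Laurent polynomials over the integers
  embedded in formal Laurent series.\<close>

definition central_trinomial :: "nat \<Rightarrow> int" where
  "central_trinomial k = fls_nth ((1 + fls_X + fls_X_inv) ^ k) 0"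

definition rat_local_ring :: "nat \<Rightarrow> rat set" where
  "rat_local_ring p = {of_int a / of_int b | a b. b \<noteq> 0 \<and> coprime b (int p)}"

text \<open>Congruence modulo the ideal generated by \<open>m\<close> in the ring of rationals with denominator
  prime to \<open>p\<close>; both sides are required to lie in that ring.\<close>

definition rat_cong :: "nat \<Rightarrow> rat \<Rightarrow> rat \<Rightarrow> rat \<Rightarrow> bool" where
  "rat_cong p m x y \<longleftrightarrow>
     x \<in> rat_local_ring p \<and> y \<in> rat_local_ring p \<and> (\<exists>z\<in>rat_local_ring p. x - y = m * z)"

end

theory Submission
  imports Defs "HOL-Number_Theory.Residues"
begin

text \<open>Since \<open>T\<^sub>k\<close> is the coefficient of \<open>x\<^sup>k\<close> in \<open>A\<^sup>k\<close> for \<open>A = 1 + x + x\<^sup>2\<close>, the sum times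
  \<open>3\<^bsup>p-1\<^esup>\<close> is the coefficient of \<open>x\<^bsup>p-1\<^esup>\<close> in \<open>(A\<^sup>p - (3x)\<^sup>p) / (A - 3x)\<close>. Here \<open>A - 3x = (1 - x)\<^sup>2\<close> and
  \<open>A (1 - x) = 1 - x\<^sup>3\<close>, so only \<open>(1 - x\<^sup>3)\<^sup>p / (1 - x)\<^bsup>p+2\<^esup>\<close> contributes, and the coefficient is the
  sum over \<open>3j < p\<close> of \<open>(-1)\<^sup>j C(p, j) C(2p - 3j, p + 1)\<close>. Modulo \<open>p\<^sup>2\<close> the term \<open>j = 0\<close> is \<open>2p\<close> and every
  other term is \<open>3p\<close>; finally \<open>3\<^bsup>p-1\<^esup>\<close> is 1 modulo \<open>p\<close>.\<close>

section \<open>Central trinomial coefficients as power series coefficients\<close>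

lemma fls_trinomial_times_X:
  "fls_X * (1 + fls_X + fls_X_inv :: int fls) = fps_to_fls (1 + fps_X + fps_X\<^sup>2)"
proof -
  have "fls_X * (fls_X_inv :: int fls) = 1"
    by (simp add: fls_X_inv_times_conv_shift fls_X_times_conv_shift)
  thus ?thesis
    by (simp add: algebra_simps power2_eq_square fls_times_fps_to_fls)
qed

text \<open>Multiplying by \<open>fls_X ^ k\<close> turns the Laurent polynomial into a power series
  and moves its constant term to index \<open>k\<close>.\<close>

lemma central_trinomial_eq_fps_nth:
  "central_trinomial k = fps_nth ((1 + fps_X + fps_X\<^sup>2) ^ k) k"
proof -
  have "fps_to_fls ((1 + fps_X + fps_X\<^sup>2 :: int fps) ^ k) = fls_X ^ k * (1 + fls_X + fls_X_inv) ^ k"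
    unfolding fps_to_fls_power fls_trinomial_times_X[symmetric] power_mult_distrib ..
  hence "fls_nth (fps_to_fls ((1 + fps_X + fps_X\<^sup>2 :: int fps) ^ k)) (int k) = central_trinomial k"
    by (simp add: central_trinomial_def fls_X_power_times_conv_shift)
  thus ?thesis by simp
qed

section \<open>Negative binomial series\<close>

text \<open>The expansion of 1 / (1 - x)^(d+1), written out by coefficients so that it makes sense
  over any commutative ring, in particular the integers.\<close>

definition fps_neg_binomial :: "nat \<Rightarrow> 'a::comm_ring_1 fps" where
  "fps_neg_binomial d = Abs_fps (\<lambda>n. of_nat ((n + d) choose d))"

text \<open>Pascal's rule, read coefficient by coefficient.\<close>

lemma one_minus_X_times_fps_neg_binomial_Suc:
  "(1 - fps_X) * fps_neg_binomial (Suc d) = (fps_neg_binomial d :: 'a::comm_ring_1 fps)"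
proof (rule fps_ext)
  fix n
  show "fps_nth ((1 - fps_X) * fps_neg_binomial (Suc d)) n = fps_nth (fps_neg_binomial d :: 'a fps) n"
    by (cases n) (simp_all add: fps_neg_binomial_def left_diff_distrib binomial_eq_0)
qed

lemma one_minus_X_power_times_fps_neg_binomial:
  "(1 - fps_X) ^ Suc d * fps_neg_binomial d = (1 :: 'a::comm_ring_1 fps)"
proof (induction d)
  case 0
  show ?case
  proof (rule fps_ext)
    fix n
    show "fps_nth ((1 - fps_X) ^ Suc 0 * fps_neg_binomial 0) n = fps_nth (1 :: 'a fps) n"
      by (cases n) (simp_all add: fps_neg_binomial_def left_diff_distrib)
  qed
next
  case (Suc d)
  have "(1 - fps_X) ^ Suc (Suc d) * fps_neg_binomial (Suc d)
      = (1 - fps_X) ^ Suc d * ((1 - fps_X) * fps_neg_binomial (Suc d) :: 'a fps)"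
    by (simp add: algebra_simps)
  thus ?case by (simp only: one_minus_X_times_fps_neg_binomial_Suc Suc.IH)
qed

section \<open>From the trinomial sum to a binomial sum\<close>

lemma sum_central_trinomial_eq_binomial_sum:
  assumes "n > 0"
  shows "(\<Sum>k<n. 3 ^ (n - 1 - k) * central_trinomial k)
       = (\<Sum>j | 3 * j < n. (-1) ^ j * int (n choose j) * int ((2 * n - 3 * j) choose (n + 1)))"
proof -
  define A :: "int fps" where "A = 1 + fps_X + fps_X\<^sup>2"
  define R :: "int fps" where "R = fps_neg_binomial (n + 1)"
  define Q where "Q = (\<Sum>k<n. (3 * fps_X) ^ (n - Suc k) * A ^ k)"
  have const3: "(3 * fps_X :: int fps) ^ m = fps_const (3 ^ m) * fps_X ^ m" for m
    by (simp add: power_mult_distrib fps_numeral_fps_const fps_const_power)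
  \<comment> \<open>In summand \<open>k\<close> the power of \<open>fps_X\<close> uses up n - 1 - k
    of the degree, leaving the coefficient of x^k in \<open>A ^ k\<close>.\<close>
  have "fps_nth Q (n - 1) = (\<Sum>k<n. 3 ^ (n - 1 - k) * central_trinomial k)"
    unfolding Q_def fps_sum_nth
  proof (rule sum.cong[OF refl])
    fix k assume "k \<in> {..<n}"
    hence "\<not> n - 1 < n - Suc k" "n - 1 - (n - Suc k) = k" by auto
    thus "fps_nth ((3 * fps_X) ^ (n - Suc k) * A ^ k) (n - 1) = 3 ^ (n - 1 - k) * central_trinomial k"
      unfolding const3 mult.assoc fps_mult_left_const_nth fps_X_power_mult_nth
      by (simp add: central_trinomial_eq_fps_nth A_def)
  qed
  moreover have "fps_nth Q (n - 1)
      = (\<Sum>j | 3 * j < n. (-1) ^ j * int (n choose j) * int ((2 * n - 3 * j) choose (n + 1)))"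
  proof -
    have sq: "A - 3 * fps_X = (1 - fps_X)\<^sup>2"
      by (simp add: A_def power2_eq_square algebra_simps)
    have cube: "A * (1 - fps_X) = 1 - fps_X ^ 3"
      by (simp add: A_def power2_eq_square power3_eq_cube algebra_simps)
    have "A ^ n - (3 * fps_X) ^ n = (1 - fps_X)\<^sup>2 * Q"
      unfolding Q_def sq[symmetric] by (rule power_diff_sumr2)
    \<comment> \<open>The extra factor (1 - x)^n turns \<open>A ^ n\<close> into the sparse
      polynomial (1 - x^3)^n.\<close>
    hence "(1 - fps_X) ^ n * ((1 - fps_X)\<^sup>2 * Q) = (A * (1 - fps_X)) ^ n - (3 * fps_X * (1 - fps_X)) ^ n"
      by (simp only: power_mult_distrib) (simp add: algebra_simps)
    hence "(1 - fps_X) ^ Suc (n + 1) * Q = (1 - fps_X ^ 3) ^ n - (3 * fps_X * (1 - fps_X)) ^ n"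
      by (simp only: cube) (simp add: power2_eq_square mult_ac)
    hence "((1 - fps_X) ^ Suc (n + 1) * R) * Q = ((1 - fps_X ^ 3) ^ n - (3 * fps_X * (1 - fps_X)) ^ n) * R"
      by (metis (no_types) mult.assoc mult.commute)
    \<comment> \<open>The subtracted series is a multiple of \<open>fps_X ^ n\<close>, hence
      invisible at index \<open>n - 1\<close>.\<close>
    hence Q: "Q = (1 - fps_X ^ 3) ^ n * R - fps_X ^ n * (3 ^ n * (1 - fps_X) ^ n * R)"
      unfolding R_def one_minus_X_power_times_fps_neg_binomial
      by (simp only: power_mult_distrib mult_1) (simp only: algebra_simps)
    have "(1 - fps_X ^ 3 :: int fps) ^ n = (- (fps_X ^ 3) + 1) ^ n" by simp
    also have "\<dots> = (\<Sum>j\<le>n. of_nat (n choose j) * (- (fps_X ^ 3)) ^ j)"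
      by (subst binomial_ring) simp
    also have "\<dots> = (\<Sum>j\<le>n. fps_const ((-1) ^ j * int (n choose j)) * fps_X ^ (3 * j))"
    proof (rule sum.cong[OF refl])
      fix j
      have "(- (fps_X ^ 3) :: int fps) ^ j = fps_const ((-1) ^ j) * fps_X ^ (3 * j)"
        by (subst power_minus) (simp add: power_mult flip: fps_const_power fps_const_neg)
      thus "of_nat (n choose j) * (- (fps_X ^ 3)) ^ j
          = fps_const ((-1) ^ j * int (n choose j)) * fps_X ^ (3 * j)"
        by (simp add: mult_ac flip: fps_of_nat fps_const_mult)
    qed
    finally have "fps_nth ((1 - fps_X ^ 3) ^ n * R) (n - 1)
        = (\<Sum>j\<le>n. (-1) ^ j * int (n choose j) * (if n - 1 < 3 * j then 0 else fps_nth R (n - 1 - 3 * j)))"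
      by (simp add: sum_distrib_right fps_sum_nth mult.assoc fps_X_power_mult_nth cong: if_cong)
    also have "\<dots> = (\<Sum>j | 3 * j < n. (-1) ^ j * int (n choose j) * int ((2 * n - 3 * j) choose (n + 1)))"
    proof (rule sum.mono_neutral_cong_right)
      fix j assume "j \<in> {j. 3 * j < n}"
      \<comment> \<open>The coefficient of x^m in \<open>R\<close> is C(m + n + 1, n + 1), here with
        m = n - 1 - 3j.\<close>
      moreover from this have "n - 1 - 3 * j + (n + 1) = 2 * n - 3 * j" by simp
      ultimately show "(-1) ^ j * int (n choose j) * (if n - 1 < 3 * j then 0 else fps_nth R (n - 1 - 3 * j))
          = (-1) ^ j * int (n choose j) * int ((2 * n - 3 * j) choose (n + 1))"
        by (simp add: R_def fps_neg_binomial_def del: binomial_Suc_Suc)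
    qed (use assms in auto)
    finally show ?thesis
      using assms by (simp add: Q fps_X_power_mult_nth)
  qed
  ultimately show ?thesis by simp
qed

section \<open>Binomial coefficients modulo a prime\<close>

text \<open>By Pascal's rule two neighbours in row p - 1 add up to an inner entry of row p, which p
  divides; so the signs alternate.\<close>

lemma prime_cong_binomial_pred:
  assumes "prime p" "k < p"
  shows "[int ((p - 1) choose k) = (-1) ^ k] (mod int p)"
  using assms(2)
proof (induction k)
  case (Suc k)
  have "p choose Suc k = (p - 1 choose k) + (p - 1 choose Suc k)"
    using Suc.prems by (cases p) simp_all
  moreover have "p dvd p choose Suc k"
    using Suc.prems assms(1) by (intro dvd_choose_prime) auto
  ultimately have "[int ((p - 1) choose k) + int ((p - 1) choose Suc k) = 0] (mod int p)"
    by (metis cong_0_iff of_nat_add of_nat_dvd_iff)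
  from cong_diff[OF this Suc.IH] Suc.prems show ?case by simp
qed simp

text \<open>Passing from m to m + 1 multiplies by (p + m + 1) / (m + 1), whose numerator and
  denominator agree modulo p and are units while m + 1 < p.\<close>

lemma prime_cong_binomial_add:
  assumes "prime p" "m < p"
  shows "[int ((p + m) choose p) = 1] (mod int p)"
  using assms(2)
proof (induction m)
  case (Suc m)
  have sym: "(p + i) choose p = (p + i) choose i" for i
    by (simp add: binomial_symmetric[of p "p + i"])
  have "int (Suc m) * int ((p + Suc m) choose p) = int (p + Suc m) * int ((p + m) choose p)"
    using Suc_times_binomial[of m "p + m"] unfolding sym
    by (metis add_Suc_right of_nat_mult)
  also have "[\<dots> = int (Suc m) * 1] (mod int p)"
    using Suc by (intro cong_mult) (auto simp: cong_iff_dvd_diff)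
  finally have "[int (Suc m) * int ((p + Suc m) choose p) = int (Suc m) * 1] (mod int p)" .
  moreover have "coprime (int (Suc m)) (int p)"
    using Suc.prems assms(1)
    by (metis coprime_commute coprime_int_iff nat_dvd_not_less prime_imp_coprime zero_less_Suc)
  ultimately show ?case by (simp only: cong_mult_lcancel)
qed simp

lemma Suc_times_binomial_Suc_right: "Suc k * (n choose Suc k) = (n - k) * (n choose k)"
  by (simp only: binomial_absorption binomial_absorb_comp)

section \<open>The terms of the binomial sum modulo the square of p\<close>

text \<open>After multiplication by the unit p + 1 a factor p splits off, so the cofactor matters
  only modulo p.\<close>

lemma binomial_term_cong:
  assumes "prime p" "0 < j" "3 * j < p"
  shows "[(-1) ^ j * int (p choose j) * int ((2 * p - 3 * j) choose (p + 1)) = 3 * int p] (mod (int p)\<^sup>2)"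
proof -
  define B where "B = int ((p + (p - 3 * j)) choose p)"
  define C where "C = int ((2 * p - 3 * j) choose (p + 1))"
  have absorb: "(int p + 1) * C = (int p - 3 * int j) * B"
  proof -
    have "Suc p * ((p + (p - 3 * j)) choose Suc p) = (p - 3 * j) * ((p + (p - 3 * j)) choose p)"
      using Suc_times_binomial_Suc_right[of p "p + (p - 3 * j)"] by simp
    moreover have "p + (p - 3 * j) = 2 * p - 3 * j" using assms by simp
    ultimately have "int (Suc p) * C = int (p - 3 * j) * B"
      unfolding B_def C_def by (metis Suc_eq_plus1 of_nat_mult)
    thus ?thesis using assms by (simp add: of_nat_diff algebra_simps)
  qed
  have times_j: "int j * int (p choose j) = int p * int ((p - 1) choose (j - 1))"
    using times_binomial_minus1_eq[of j p] assms by (metis of_nat_mult)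
  obtain q where q: "int (p choose j) = int p * q"
    using assms dvd_choose_prime[of j p] by (auto simp flip: of_nat_dvd_iff)
  have B: "[B = 1] (mod int p)"
    unfolding B_def using assms by (intro prime_cong_binomial_add) auto
  have "(-1) ^ j * int (p choose j) * C * (int p + 1)
      = (-1) ^ j * int (p choose j) * ((int p - 3 * int j) * B)"
    by (subst absorb[symmetric]) (simp only: mult_ac)
  \<comment> \<open>The j in p - 3j is absorbed by \<open>times_j\<close>, so nothing is divided by
    j. The other part, p C(p, j), is divisible by p twice.\<close>
  also have "\<dots> = int p * ((-1) ^ j * (int p * q - 3 * int ((p - 1) choose (j - 1))) * B)"
    using times_j q by (auto simp: algebra_simps)
  finally have main: "(-1) ^ j * int (p choose j) * C * (int p + 1) = \<dots>" .
  have "[(-1) ^ j * (int p * q - 3 * int ((p - 1) choose (j - 1))) * B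
      = (-1) ^ j * (0 - 3 * (-1) ^ (j - 1)) * 1] (mod int p)"
    using assms B by (intro cong_mult cong_diff prime_cong_binomial_pred cong_refl)
      (auto simp: cong_0_iff)
  also have "(-1) ^ j * (0 - 3 * (-1) ^ (j - 1)) * 1 = (3 :: int)"
    using assms(2) by (cases j) (auto simp flip: power_mult_distrib)
  finally have "[int p * ((-1) ^ j * (int p * q - 3 * int ((p - 1) choose (j - 1))) * B) = int p * 3]
      (mod (int p * int p))"
    by (rule cong_cmult_leftI)
  \<comment> \<open>Inserting p + 1, which is 1 modulo p, prepares its cancellation.\<close>
  also have "[int p * 3 = 3 * int p * (int p + 1)] (mod (int p * int p))"
    by (simp add: cong_iff_dvd_diff algebra_simps)
  finally have "[(-1) ^ j * int (p choose j) * C * (int p + 1) = 3 * int p * (int p + 1)] (mod (int p)\<^sup>2)"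
    by (simp only: main power2_eq_square)
  moreover have "coprime (int p + 1) ((int p)\<^sup>2)"
    by simp
  ultimately show ?thesis unfolding C_def by (simp only: cong_mult_rcancel)
qed

text \<open>Here C(p, 0) = 1 supplies no factor p; it comes from lowering the index p + 1 to p
  instead.\<close>

lemma binomial_term_0_cong:
  assumes "prime p"
  shows "[int ((2 * p) choose (p + 1)) = 2 * int p] (mod (int p)\<^sup>2)"
proof -
  have p: "p > 0" using assms prime_gt_0_nat by blast
  have "Suc p * ((2 * p) choose Suc p) = p * ((2 * p) choose p)"
    using Suc_times_binomial_Suc_right[of p "2 * p"] by (simp del: mult_Suc)
  \<comment> \<open>\<open>prime_cong_binomial_add\<close> requires m < p, so the central
    coefficient is first halved by symmetry to reach m = p - 1.\<close>
  also have "(2 * p) choose p = 2 * ((p + (p - 1)) choose p)"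
  proof -
    have "(2 * p) choose p = ((p + (p - 1)) choose (p - 1)) + ((p + (p - 1)) choose p)"
      using p by (cases p) (simp_all add: mult_2)
    moreover have "(p + (p - 1)) choose (p - 1) = (p + (p - 1)) choose p"
      using p binomial_symmetric[of p "p + (p - 1)"] by simp
    ultimately show ?thesis by simp
  qed
  finally have main: "int ((2 * p) choose (p + 1)) * (int p + 1) = int p * (2 * int ((p + (p - 1)) choose p))"
    by (metis Suc_eq_plus1 mult.commute of_nat_Suc of_nat_mult of_nat_numeral add.commute)
  have "[2 * int ((p + (p - 1)) choose p) = 2 * 1] (mod int p)"
    using assms p by (intro cong_mult cong_refl prime_cong_binomial_add) auto
  hence "[int p * (2 * int ((p + (p - 1)) choose p)) = int p * (2 * 1)] (mod (int p * int p))"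
    by (rule cong_cmult_leftI)
  also have "[int p * (2 * 1) = 2 * int p * (int p + 1)] (mod (int p * int p))"
    by (simp add: cong_iff_dvd_diff algebra_simps)
  finally have "[int ((2 * p) choose (p + 1)) * (int p + 1) = 2 * int p * (int p + 1)] (mod (int p)\<^sup>2)"
    by (simp only: main power2_eq_square)
  moreover have "coprime (int p + 1) ((int p)\<^sup>2)"
    by simp
  ultimately show ?thesis by (simp only: cong_mult_rcancel)
qed

lemma sum_central_trinomial_cong:
  assumes "prime p"
  shows "[(\<Sum>k<p. 3 ^ (p - 1 - k) * central_trinomial k)
        = 2 * int p + 3 * int p * int ((p - 1) div 3)] (mod (int p)\<^sup>2)"
proof -
  have p: "p > 0" using assms prime_gt_0_nat by blast
  define f where "f j = (-1) ^ j * int (p choose j) * int ((2 * p - 3 * j) choose (p + 1))" for j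
  have "{j. 3 * j < p} = insert 0 {1..(p - 1) div 3}"
    using p by auto
  hence "(\<Sum>k<p. 3 ^ (p - 1 - k) * central_trinomial k) = f 0 + (\<Sum>j\<in>{1..(p - 1) div 3}. f j)"
    using sum_central_trinomial_eq_binomial_sum[OF p] by (simp add: f_def)
  also have "[\<dots> = 2 * int p + (\<Sum>j\<in>{1..(p - 1) div 3}. 3 * int p)] (mod (int p)\<^sup>2)"
  proof (intro cong_add cong_sum)
    show "[f 0 = 2 * int p] (mod (int p)\<^sup>2)"
      using binomial_term_0_cong[OF assms] by (simp add: f_def)
    show "[f j = 3 * int p] (mod (int p)\<^sup>2)" if "j \<in> {1..(p - 1) div 3}" for j
      unfolding f_def using that assms p by (intro binomial_term_cong) auto
  qed
  finally show ?thesis by (simp add: mult_ac)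
qed

section \<open>Passage to rational congruences and conclusion\<close>

lemma rat_cong_of_int_divide:
  assumes "coprime b (int p)" "b \<noteq> 0" "[a = b * c] (mod m)"
  shows "rat_cong p (of_int m) (of_int a / of_int b) (of_int c)"
proof -
  obtain d where "a - b * c = m * d"
    using assms(3) by (auto simp: cong_iff_dvd_diff)
  hence a: "a = b * c + m * d" by simp
  have "(of_int a / of_int b - of_int c :: rat) = of_int m * (of_int d / of_int b)"
    using assms(2) by (simp add: a field_simps)
  moreover have "(of_int x / of_int b :: rat) \<in> rat_local_ring p" for x
    unfolding rat_local_ring_def using assms by blast
  moreover have "(of_int c :: rat) = of_int c / of_int 1" by simp
  hence "(of_int c :: rat) \<in> rat_local_ring p"
    unfolding rat_local_ring_def by (metis (mono_tags, lifting) CollectI coprime_1_left zero_neq_one)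
  ultimately show ?thesis unfolding rat_cong_def by blast
qed

theorem theorem1p4:
  fixes p :: nat
  assumes "prime p" and "p > 3"
  shows "([p = 1] (mod 3) \<longrightarrow>
           rat_cong p (of_nat (p\<^sup>2)) (\<Sum>k=0..p-1. of_int (central_trinomial k) / 3 ^ k) (of_nat p))
       \<and> ([p = 2] (mod 3) \<longrightarrow>
           rat_cong p (of_nat (p\<^sup>2)) (\<Sum>k=0..p-1. of_int (central_trinomial k) / 3 ^ k) 0)"
proof -
  define M where "M = (\<Sum>k<p. 3 ^ (p - 1 - k) * central_trinomial k)"
  define S :: rat where "S = (\<Sum>k=0..p-1. of_int (central_trinomial k) / 3 ^ k)"
  have range: "{0..p-1} = {..<p}" using assms by auto
  have "S * 3 ^ (p - 1) = of_int M"
    unfolding S_def M_def range sum_distrib_right of_int_sum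
  proof (rule sum.cong[OF refl])
    fix k assume "k \<in> {..<p}"
    hence "p - 1 = k + (p - 1 - k)" by auto
    hence "(3 :: rat) ^ (p - 1) = 3 ^ k * 3 ^ (p - 1 - k)"
      by (metis power_add)
    thus "of_int (central_trinomial k) / 3 ^ k * 3 ^ (p - 1)
        = (of_int (3 ^ (p - 1 - k) * central_trinomial k) :: rat)"
      by simp
  qed
  hence S: "S = of_int M / of_int (3 ^ (p - 1))"
    by (simp add: eq_divide_eq)
  have "\<not> p dvd 3" using assms by (auto dest: dvd_imp_le)
  hence "[3 ^ (p - 1) = 1] (mod p)"
    using assms fermat_theorem by blast
  hence fermat: "[3 ^ (p - 1) = 1] (mod int p)"
    by (metis cong_int_iff of_nat_1 of_nat_numeral of_nat_power)
  have "coprime (3 ^ (p - 1)) (int p)"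
    using fermat cong_imp_coprime[OF cong_sym[OF fermat]] by simp
  hence lift: "rat_cong p (of_nat (p\<^sup>2)) S (of_int c)" if "[M = 3 ^ (p - 1) * c] (mod (int p)\<^sup>2)" for c
    using rat_cong_of_int_divide[OF _ _ that, of p] by (simp add: S)
  have M: "[M = 2 * int p + 3 * int p * int ((p - 1) div 3)] (mod (int p)\<^sup>2)"
    unfolding M_def using assms(1) by (rule sum_central_trinomial_cong)
  show ?thesis unfolding S_def[symmetric]
  proof (intro conjI impI)
    assume "[p = 1] (mod 3)"
    then obtain t where t: "p = 3 * t + 1"
      using mult_div_mod_eq[of 3 p] by (simp add: cong_def) metis
    have eq: "2 * int p + 3 * int p * int ((p - 1) div 3) = int p + (int p)\<^sup>2"
      by (simp add: t power2_eq_square algebra_simps)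
    have "[M = int p] (mod (int p)\<^sup>2)"
      using M unfolding eq by (simp add: cong_def)
    \<comment> \<open>Fermat holds only modulo p; the factor p lifts it to the square.\<close>
    also have "[int p = 3 ^ (p - 1) * int p] (mod (int p)\<^sup>2)"
      using cong_cmult_leftI[OF cong_sym[OF fermat], of "int p"]
      by (simp add: power2_eq_square mult.commute)
    finally show "rat_cong p (of_nat (p\<^sup>2)) S (of_nat p)"
      using lift[of "int p"] by simp
  next
    assume "[p = 2] (mod 3)"
    then obtain t where t: "p = 3 * t + 2"
      using mult_div_mod_eq[of 3 p] by (simp add: cong_def) metis
    have "(p - 1) div 3 = t" using t by simp
    hence "2 * int p + 3 * int p * int ((p - 1) div 3) = (int p)\<^sup>2"
      by (simp add: t power2_eq_square algebra_simps)
    with M have "[M = 3 ^ (p - 1) * 0] (mod (int p)\<^sup>2)"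
      by (simp add: cong_def)
    from lift[OF this] show "rat_cong p (of_nat (p\<^sup>2)) S 0" by simp
  qed
qed

end
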